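(* Let $T:\mathbb{R}_A\to\mathbb{R}_B$ be a parameter transformation, let $D$ be a continuous probability distribution on $\mathbb{R}$, and let $I$ be an interval in the domain $\mathbb{R}_A$ of $T$, given as a midpoint-width pair of either finite (real) width or infinitesimal width. Then $$P(T(D),T(I)) = P(D,I),$$ where $P$ is the (possibly infinitesimal) probability of an interval, and $T(D)$, $T(I)$ are the transformed distribution and the transformed interval, all as defined in the context.
   Context: **Infinitesimal numbers.** An infinitesimal number is a pair $(r,n)\in\mathbb{R}\times\mathbb{Z}$, written $r\epsilon^n$. Real numbers $r$ correspond to $r\epsilon^0$. Multiplication is $(r\epsilon^n)\cdot(s\epsilon^k)=(rs)\epsilon^{n+k}$; in particular $c\cdot r\epsilon^n=(cr)\epsilon^n$ for $c\in\mathbb{R}$. **Intervals and their probability.** An interval is represented by a midpoint-width pair $(a,w)$ with $a\in\mathbb{R}$. The width $w$ is either a real number $r$ (identified with $r\epsilon^0$; the interval then stands for $[a-\frac12 r,a+\frac12 r]$) or infinitesimal, i.e. $w=r\epsilon^n$ with $n>0$. For a continuous distribution $D$ with cumulative distribution function $\mathsf{cdf}(D,\cdot)$ and probability density function $\mathsf{pdf}(D,\cdot)$, $$P(D,(a,w))=\begin{cases}\mathsf{cdf}(D,a+\frac12 r)-\mathsf{cdf}(D,a-\frac12 r) & \text{if } w=r\epsilon^0\\ \mathsf{pdf}(D,a)\cdot r\epsilon^{n} & \text{if } w=r\epsilon^{n},\ n>0.\end{cases}$$ **Parameter transformations.** A parameter transformation $T:\mathbb{R}_A\to\mathbb{R}_B$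 is a continuously differentiable function with $T'(x)>0$ for all $x\in\mathbb{R}_A$, where $\mathbb{R}_A,\mathbb{R}_B\subseteq\mathbb{R}$ are intervals representing its domain and range. It is strictly increasing, and $T^{-1}$ denotes its inverse, defined on the set of values of $T$. **Transformed distribution.** For a continuous distribution $D$, $T(D)$ is given by the following operations, for $y$ in the set of values of $T$: $$\mathsf{cdf}(T(D),y)=\mathsf{cdf}(D,T^{-1}(y)),\qquad \mathsf{pdf}(T(D),y)=\mathsf{pdf}(D,T^{-1}(y))\cdot (T^{-1})'(y).$$ **Transformed interval.** For $(a,w)$ with real width $w$, put $l=T(a-\frac w2)$, $r=T(a+\frac w2)$ and define $T((a,w))=\left(\frac{l+r}{2},\,r-l\right)$. For $(a,w)$ with infinitesimal width $w$, define $T((a,w))=(T(a),\,T'(a)\cdot w)$. "The interval is in the domain of $T$" means that $a-\frac w2$ and $a+\frac w2$ lie in $\mathbb{R}_A$ if $w$ is real, and that $a\in\mathbb{R}_A$ if $w$ is infinitesimal. *)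

theory Defs
  imports "HOL-Probability.Probability"
begin

(* Eps r n stands for r * epsilon^n. Equality is equality of pairs, so zeros of
   different order are distinct. *)
datatype infnum = Eps (coeff: real) (order: int)

instantiation infnum :: times
begin

definition times_infnum :: "infnum \<Rightarrow> infnum \<Rightarrow> infnum" where
  "x * y = Eps (coeff x * coeff y) (order x + order y)"

instance ..

end

definition inf_of_real :: "real \<Rightarrow> infnum" where
  "inf_of_real r = Eps r 0"

type_synonym mw_interval = "real \<times> infnum"

(* Negative powers of epsilon are infinitesimal numbers but not widths. *)
definition mw_interval :: "mw_interval \<Rightarrow> bool" where
  "mw_interval I \<longleftrightarrow> 0 \<le> order (snd I)"

(* A distribution is accessed only through these two operations. This bare record
   also holds transformed distributions, whose operations are meaningful only on the
   set of values of the transformation. The density is part of the data because its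
   point values matter for infinitesimal widths. *)
record dist_ops =
  cdf_of :: "real \<Rightarrow> real"
  pdf_of :: "real \<Rightarrow> real"

definition continuous_distribution :: "dist_ops \<Rightarrow> bool" where
  "continuous_distribution D \<longleftrightarrow>
     pdf_of D \<in> borel_measurable borel \<and>
     (\<forall>x. 0 \<le> pdf_of D x) \<and>
     prob_space (density lborel (\<lambda>x. ennreal (pdf_of D x))) \<and>
     cdf_of D = cdf (density lborel (\<lambda>x. ennreal (pdf_of D x)))"

fun interval_prob :: "dist_ops \<Rightarrow> mw_interval \<Rightarrow> infnum" where
  "interval_prob D (a, Eps r n) =
     (if n = 0 then inf_of_real (cdf_of D (a + r / 2) - cdf_of D (a - r / 2))
      else if n > 0 then inf_of_real (pdf_of D a) * Eps r n
      else undefined)"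

(* The derivative relative to S: one-sided at an endpoint belonging to S. *)
definition deriv_on :: "real set \<Rightarrow> (real \<Rightarrow> real) \<Rightarrow> real \<Rightarrow> real" where
  "deriv_on S f x = vector_derivative f (at x within S)"

(* The domain must contain two points, since otherwise the derivative relative to it
   is not determined. B is a codomain: it need not equal the set of values. *)
definition param_transformation :: "real set \<Rightarrow> real set \<Rightarrow> (real \<Rightarrow> real) \<Rightarrow> bool" where
  "param_transformation A B T \<longleftrightarrow>
     is_interval A \<and> is_interval B \<and> (\<exists>x\<in>A. \<exists>y\<in>A. x < y) \<and>
     T \<in> A \<rightarrow> B \<and>
     T differentiable_on A \<and> continuous_on A (deriv_on A T) \<and>
     (\<forall>x\<in>A. 0 < deriv_on A T x)"

definition transform_dist :: "real set \<Rightarrow> (real \<Rightarrow> real) \<Rightarrow> dist_ops \<Rightarrow> dist_ops" where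
  "transform_dist A T D =
     \<lparr> cdf_of = (\<lambda>y\<in>T ` A. cdf_of D (inv_into A T y)),
       pdf_of = (\<lambda>y\<in>T ` A. pdf_of D (inv_into A T y) * deriv_on (T ` A) (inv_into A T) y) \<rparr>"

fun transform_interval :: "real set \<Rightarrow> (real \<Rightarrow> real) \<Rightarrow> mw_interval \<Rightarrow> mw_interval" where
  "transform_interval A T (a, Eps w n) =
     (if n = 0 then
        (let l = T (a - w / 2); r = T (a + w / 2) in ((l + r) / 2, inf_of_real (r - l)))
      else if n > 0 then (T a, inf_of_real (deriv_on A T a) * Eps w n)
      else undefined)"

fun interval_in_domain :: "real set \<Rightarrow> mw_interval \<Rightarrow> bool" where
  "interval_in_domain A (a, Eps w n) \<longleftrightarrow>
     (if n = 0 then a - w / 2 \<in> A \<and> a + w / 2 \<in> A else a \<in> A)"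

end

theory Submission
  imports Defs
begin

text \<open>
  For a real width, the transformed interval has the endpoints \<open>T (a - w/2)\<close> and \<open>T (a + w/2)\<close>,
  and \<open>T\<inverse>\<close> undoes \<open>T\<close> there. For an infinitesimal width, the factors \<open>T' a\<close> and \<open>(T\<inverse>)' (T a)\<close>
  cancel. Since \<open>a\<close> may be an endpoint of the domain, the inverse function rule is needed for
  derivatives relative to a set, where the library versions at interior points do not apply.
\<close>

text \<open>A connected set with more than one point has no isolated points. This is what makes
  derivatives relative to \<open>S\<close> unique, also at endpoints.\<close>

lemma at_within_is_interval_neq_bot:
  fixes S :: "real set"
  assumes "is_interval S" "x \<in> S" "y \<in> S" "x < y" "a \<in> S"
  shows "at a within S \<noteq> bot"
proof -
  have "connected S"
    using assms(1) by (simp add: is_interval_connected_1)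
  moreover have "S \<noteq> {z}" for z
    using assms by auto
  ultimately show ?thesis
    using connected_imp_perfect[of S a] assms(5) by (simp add: trivial_limit_within)
qed

text \<open>The difference quotient of the inverse at \<open>f a\<close> is the reciprocal of that
  of \<open>f\<close> at \<open>a\<close>, evaluated along the inverse, which tends to
  \<open>a\<close> by continuity.\<close>

lemma has_real_derivative_inv_into:
  fixes f :: "real \<Rightarrow> real"
  assumes der: "(f has_real_derivative d) (at a within S)" and "d \<noteq> 0"
    and inj: "inj_on f S" and a: "a \<in> S"
    and cont: "continuous_on (f ` S) (inv_into S f)"
  shows "(inv_into S f has_real_derivative inverse d) (at (f a) within f ` S)"
proof -
  let ?g = "inv_into S f"
  have "(?g \<longlongrightarrow> a) (at (f a) within f ` S)"
    using cont a inv_into_f_f[OF inj a] by (auto simp: continuous_on_def)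
  \<comment> \<open>The filter at \<open>a\<close> within \<open>S\<close> leaves out
    \<open>a\<close> itself. For \<open>y\<close> in the image, \<open>?g y = a\<close> would force
    \<open>y = f a\<close>.\<close>
  moreover have "eventually (\<lambda>y. ?g y \<in> S \<and> ?g y \<noteq> a) (at (f a) within f ` S)"
    unfolding eventually_at_filter by (auto intro!: always_eventually simp: inj)
  ultimately have g: "filterlim ?g (at a within S) (at (f a) within f ` S)"
    by (simp add: filterlim_at)
  have "((\<lambda>x. (f x - f a) / (x - a)) \<longlongrightarrow> d) (at a within S)"
    using der by (simp add: has_field_derivative_iff)
  from tendsto_inverse[OF filterlim_compose[OF this g] \<open>d \<noteq> 0\<close>]
  have "((\<lambda>y. inverse ((f (?g y) - f a) / (?g y - a))) \<longlongrightarrow> inverse d) (at (f a) within f ` S)" .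
  then have "((\<lambda>y. (?g y - ?g (f a)) / (y - f a)) \<longlongrightarrow> inverse d) (at (f a) within f ` S)"
    by (rule Lim_transform_eventually)
      (auto intro!: always_eventually simp: eventually_at_filter inj a f_inv_into_f)
  then show ?thesis
    by (simp add: has_field_derivative_iff)
qed

lemma has_real_derivative_deriv_on:
  assumes "f differentiable_on S" "x \<in> S"
  shows "(f has_real_derivative deriv_on S f x) (at x within S)"
  using assms vector_derivative_works
  by (auto simp: differentiable_on_def deriv_on_def has_real_derivative_iff_has_vector_derivative)

context
  fixes A B :: "real set" and T :: "real \<Rightarrow> real"
  assumes T: "param_transformation A B T"
begin

lemma param_transformation_has_derivative:
  "x \<in> A \<Longrightarrow> (T has_real_derivative deriv_on A T x) (at x within A)"
  using T has_real_derivative_deriv_on by (simp add: param_transformation_def)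

text \<open>Mean value theorem on \<open>{x..y}\<close>, which lies in \<open>A\<close> because
  \<open>A\<close> is an interval; the derivative relative to \<open>A\<close> restricts to
  it.\<close>

lemma param_transformation_strict_mono_on: "strict_mono_on A T"
proof (rule strict_mono_onI)
  fix x y assume xy: "x \<in> A" "y \<in> A" "x < y"
  have sub: "{x..y} \<subseteq> A"
    using T xy by (auto simp: param_transformation_def intro: mem_is_interval_1_I)
  obtain z where "z \<in> {x<..<y}" "T y - T x = deriv_on A T z * (y - x)"
    using mvt_simple[OF \<open>x < y\<close>, of T "\<lambda>z. (*) (deriv_on A T z)"]
      has_derivative_subset[OF _ sub] param_transformation_has_derivative sub
    by (force simp: has_field_derivative_def)
  moreover from this(1) sub have "z \<in> A"
    by auto
  then have "0 < deriv_on A T z"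
    using T by (simp add: param_transformation_def)
  ultimately show "T x < T y"
    using \<open>x < y\<close> by (smt (verit) mult_pos_pos)
qed

lemma param_transformation_inj_on: "inj_on T A"
  by (rule strict_mono_on_imp_inj_on[OF param_transformation_strict_mono_on])

lemma param_transformation_deriv_on_inv_into:
  assumes a: "a \<in> A"
  shows "deriv_on (T ` A) (inv_into A T) (T a) = inverse (deriv_on A T a)"
proof -
  have A: "is_interval A" and pos: "deriv_on A T a \<noteq> 0"
    using T a by (auto simp: param_transformation_def)
  have cont: "continuous_on A T"
    using T differentiable_imp_continuous_on by (auto simp: param_transformation_def)
  obtain x y where xy: "x \<in> A" "y \<in> A" "x < y"
    using T by (auto simp: param_transformation_def)
  have "is_interval (T ` A)"
    using connected_continuous_image[OF cont] A by (simp add: is_interval_connected_1)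
  then have nb: "at (T a) within T ` A \<noteq> bot"
    using xy a strict_mono_onD[OF param_transformation_strict_mono_on xy]
    by (intro at_within_is_interval_neq_bot[of _ "T x" "T y"]) auto
  \<comment> \<open>A continuous injection on a real interval is a homeomorphism onto its image. Its
    inverse \<open>g\<close> agrees with \<open>inv_into A T\<close> there, which gives the
    continuity of the latter.\<close>
  obtain g where g: "homeomorphism A (T ` A) T g"
    using homeomorphism_into_1d[OF _ cont refl param_transformation_inj_on] A
    by (auto simp: is_interval_path_connected)
  have "continuous_on (T ` A) (inv_into A T)"
    using homeomorphism_cont2[OF g]
    by (rule continuous_on_eq)
      (auto simp: homeomorphism_apply1[OF g] param_transformation_inj_on)
  from has_real_derivative_inv_into[OF param_transformation_has_derivative[OF a] pos
      param_transformation_inj_on a this]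
  show ?thesis
    unfolding deriv_on_def
    by (intro vector_derivative_within[OF nb])
      (simp add: has_real_derivative_iff_has_vector_derivative)
qed

end

theorem lemma5p11:
  fixes T :: "real \<Rightarrow> real" and A B :: "real set" and D :: dist_ops and I :: mw_interval
  assumes "param_transformation A B T"
    and "continuous_distribution D"
    and "mw_interval I"
    and "interval_in_domain A I"
  shows "interval_prob (transform_dist A T D) (transform_interval A T I) = interval_prob D I"
proof -
  obtain a w n where I: "I = (a, Eps w n)"
    by (metis infnum.exhaust surj_pair)
  have n: "n \<ge> 0"
    using assms(3) by (simp add: I mw_interval_def)
  note inj = param_transformation_inj_on[OF assms(1)]
  show ?thesis
  proof (cases "n = 0")
    case True
    let ?l = "a - w / 2" and ?r = "a + w / 2"
    have "?l \<in> A" "?r \<in> A"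
      using assms(4) True by (auto simp: I)
    \<comment> \<open>Midpoint plus or minus half the width recovers the images of the endpoints,
      where \<open>inv_into A T\<close> returns \<open>?r\<close> and \<open>?l\<close>.\<close>
    moreover have "(T ?l + T ?r) / 2 + (T ?r - T ?l) / 2 = T ?r"
        "(T ?l + T ?r) / 2 - (T ?r - T ?l) / 2 = T ?l"
      by (simp_all add: field_simps)
    ultimately show ?thesis
      using True inj by (simp add: I Let_def inf_of_real_def transform_dist_def)
  next
    case False
    then have a: "a \<in> A" and "n > 0"
      using assms(4) n by (auto simp: I)
    \<comment> \<open>Being nonzero, this factor cancels against its inverse; being real, it has
      order 0 and leaves \<open>n\<close> unchanged.\<close>
    moreover have "deriv_on A T a > 0"
      using assms(1) a by (simp add: param_transformation_def)
    ultimately show ?thesis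
      using inj param_transformation_deriv_on_inv_into[OF assms(1) a]
      by (simp add: I inf_of_real_def times_infnum_def transform_dist_def)
  qed
qed

end
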